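(* Let $\mathcal{G}$ be a directed graph and $k\neq j$ nodes such that the connection subgraph $\mathcal{C}_\mathcal{G}(k,j)$ is a directed tree with unit weight on every edge. Let $n$ be the length of a shortest directed path from $k$ to a node reachable from both $k$ and $j$, and $m$ the length of a shortest directed path from $j$ to a node reachable from both $k$ and $j$. Then $$r_{k,j}=2(n-m)+2^{3-n-m}\sum_{i=1}^{\lfloor (m+1)/2\rfloor} i\binom{n+m+2}{n+2i+1}.$$
   Context: A (weighted directed) graph has nonnegative adjacency matrix $A=[a_{i,j}]$ with $a_{i,j}>0$ iff there is an edge from $i$ to $j$ (weight $a_{i,j}$). Out-degree $d_k=\sum_j a_{k,j}$, $D=\mathrm{diag}(d_k)$, Laplacian $L=D-A$. A node is reachable from another if there is a directed path (possibly of length $0$) from the latter to the former. A graph is connected if it contains a node reachable from every node. For a connected graph on $N$ nodes: $\Pi=I_N-\frac1N\mathbf{1}_N\mathbf{1}_N^T$, $Q\in\mathbb{R}^{(N-1)\times N}$ with $Q\mathbf{1}_N=0$, $QQ^T=I_{N-1}$, $Q^TQ=\Pi$; $\overline L=QLQ^T$; $\Sigma$ the unique solution of $\overline L\Sigma+\Sigma\overline L^T=I_{N-1}$; $X=2Q^T\Sigma Q$; $r_{k,j}=x_{k,k}+x_{j,j}-2x_{k,j}$. A connection between $k$ and $j$ consists of two directed paths, one starting at $k$ and one at $j$, ending at a common node (one may be trivial). The connection subgraph $\mathcal{C}_\mathcal{G}(k,j)$ is a maximal connected subgraph of $\mathcal{G}$ in which every node and edge is part of a connection between $k$ and $j$;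 when unique, $r_{k,j}$ in $\mathcal{G}$ is by definition the effective resistance between $k$ and $j$ computed in $\mathcal{C}_\mathcal{G}(k,j)$. A directed tree is a graph whose underlying undirected graph is a tree and in which all edges are directed towards a single root (every non-root node has exactly one outgoing edge). Binomial coefficients are $\binom{a}{b}=\frac{a!}{b!(a-b)!}$ for $0\le b\le a$, and an empty sum is $0$. *)

theory Defs
  imports Complex_Main
begin

text \<open>A weighted directed graph is given by a finite node set V and a weight
  function w, with an edge from u to v iff w u v > 0.\<close>

definition edges :: "('a \<Rightarrow> 'a \<Rightarrow> real) \<Rightarrow> ('a \<times> 'a) set" where
  "edges w = {(u, v). w u v > 0}"

text \<open>Directed path (no repeated nodes, possibly of length 0) in edge set E, as a node list.\<close>
definition dpath :: "('a \<times> 'a) set \<Rightarrow> 'a list \<Rightarrow> bool" where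
  "dpath E xs \<longleftrightarrow> xs \<noteq> [] \<and> distinct xs \<and>
     (\<forall>i. Suc i < length xs \<longrightarrow> (xs ! i, xs ! Suc i) \<in> E)"

text \<open>Connectivity: some node is reachable from every node.\<close>
definition connected_graph :: "'a set \<Rightarrow> ('a \<times> 'a) set \<Rightarrow> bool" where
  "connected_graph S F \<longleftrightarrow> (\<exists>c\<in>S. \<forall>u\<in>S. (u, c) \<in> F\<^sup>*)"

text \<open>Laplacian of the weighted graph on node set S with weights a.\<close>
definition laplacian :: "'a set \<Rightarrow> ('a \<Rightarrow> 'a \<Rightarrow> real) \<Rightarrow> 'a \<Rightarrow> 'a \<Rightarrow> real" where
  "laplacian S a u v = (if u = v then (\<Sum>x\<in>S. a u x) else 0) - a u v"

text \<open>Q: an (N-1) x N matrix (rows 0..N-2, columns indexed by S) with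
  Q 1 = 0, Q Q^T = I, Q^T Q = I - (1/N) 1 1^T.\<close>
definition valid_Q :: "'a set \<Rightarrow> (nat \<Rightarrow> 'a \<Rightarrow> real) \<Rightarrow> bool" where
  "valid_Q S Q \<longleftrightarrow>
     (\<forall>p < card S - 1. (\<Sum>u\<in>S. Q p u) = 0) \<and>
     (\<forall>p < card S - 1. \<forall>q < card S - 1.
        (\<Sum>u\<in>S. Q p u * Q q u) = (if p = q then 1 else 0)) \<and>
     (\<forall>u\<in>S. \<forall>v\<in>S.
        (\<Sum>p < card S - 1. Q p u * Q p v) = (if u = v then 1 else 0) - 1 / real (card S))"

definition reduced_laplacian :: "'a set \<Rightarrow> ('a \<Rightarrow> 'a \<Rightarrow> real) \<Rightarrow> (nat \<Rightarrow> 'a \<Rightarrow> real)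
    \<Rightarrow> nat \<Rightarrow> nat \<Rightarrow> real" where
  "reduced_laplacian S a Q p q = (\<Sum>u\<in>S. \<Sum>v\<in>S. Q p u * laplacian S a u v * Q q v)"

text \<open>Sigma solves Lbar Sigma + Sigma Lbar^T = I (an (N-1)x(N-1) matrix; zero outside).\<close>
definition lyap_sol :: "'a set \<Rightarrow> ('a \<Rightarrow> 'a \<Rightarrow> real) \<Rightarrow> (nat \<Rightarrow> 'a \<Rightarrow> real)
    \<Rightarrow> (nat \<Rightarrow> nat \<Rightarrow> real) \<Rightarrow> bool" where
  "lyap_sol S a Q \<Sigma> \<longleftrightarrow>
     (\<forall>p q. (card S - 1 \<le> p \<or> card S - 1 \<le> q) \<longrightarrow> \<Sigma> p q = 0) \<and>
     (\<forall>p < card S - 1. \<forall>q < card S - 1.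
        (\<Sum>s < card S - 1. reduced_laplacian S a Q p s * \<Sigma> s q)
      + (\<Sum>s < card S - 1. \<Sigma> p s * reduced_laplacian S a Q q s)
      = (if p = q then 1 else 0))"

definition Xmat :: "'a set \<Rightarrow> ('a \<Rightarrow> 'a \<Rightarrow> real) \<Rightarrow> 'a \<Rightarrow> 'a \<Rightarrow> real" where
  "Xmat S a u v =
     (let Q = (SOME Q. valid_Q S Q);
          \<Sigma> = (THE \<Sigma>. lyap_sol S a Q \<Sigma>)
      in 2 * (\<Sum>p < card S - 1. \<Sum>q < card S - 1. Q p u * \<Sigma> p q * Q q v))"

text \<open>Effective resistance r_{k,j} = x_kk + x_jj - 2 x_kj of a connected graph.\<close>
definition eff_res :: "'a set \<Rightarrow> ('a \<Rightarrow> 'a \<Rightarrow> real) \<Rightarrow> 'a \<Rightarrow> 'a \<Rightarrow> real" where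
  "eff_res S a k j = Xmat S a k k + Xmat S a j j - 2 * Xmat S a k j"

text \<open>Connections between k and j.\<close>
definition is_connection :: "('a \<times> 'a) set \<Rightarrow> 'a \<Rightarrow> 'a \<Rightarrow> 'a list \<Rightarrow> 'a list \<Rightarrow> bool" where
  "is_connection E k j p q \<longleftrightarrow> dpath E p \<and> dpath E q \<and> hd p = k \<and> hd q = j \<and> last p = last q"

definition conn_node :: "('a \<times> 'a) set \<Rightarrow> 'a \<Rightarrow> 'a \<Rightarrow> 'a \<Rightarrow> bool" where
  "conn_node E k j x \<longleftrightarrow> (\<exists>p q. is_connection E k j p q \<and> x \<in> set p \<union> set q)"

definition conn_edge :: "('a \<times> 'a) set \<Rightarrow> 'a \<Rightarrow> 'a \<Rightarrow> 'a \<times> 'a \<Rightarrow> bool" where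
  "conn_edge E k j e \<longleftrightarrow> (\<exists>p q. is_connection E k j p q \<and>
      e \<in> set (zip p (tl p)) \<union> set (zip q (tl q)))"

text \<open>Subgraphs (S, F) of G = (V, w): connected, every node and edge part of a connection.\<close>
definition conn_candidate :: "'a set \<Rightarrow> ('a \<Rightarrow> 'a \<Rightarrow> real) \<Rightarrow> 'a \<Rightarrow> 'a
    \<Rightarrow> 'a set \<times> ('a \<times> 'a) set \<Rightarrow> bool" where
  "conn_candidate V w k j C \<longleftrightarrow>
     fst C \<subseteq> V \<and> snd C \<subseteq> edges w \<and> snd C \<subseteq> fst C \<times> fst C \<and>
     connected_graph (fst C) (snd C) \<and>
     (\<forall>x\<in>fst C. conn_node (edges w) k j x) \<and>
     (\<forall>e\<in>snd C. conn_edge (edges w) k j e)"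

definition is_conn_subgraph :: "'a set \<Rightarrow> ('a \<Rightarrow> 'a \<Rightarrow> real) \<Rightarrow> 'a \<Rightarrow> 'a
    \<Rightarrow> 'a set \<times> ('a \<times> 'a) set \<Rightarrow> bool" where
  "is_conn_subgraph V w k j C \<longleftrightarrow> conn_candidate V w k j C \<and>
     (\<forall>C'. conn_candidate V w k j C' \<and> fst C \<subseteq> fst C' \<and> snd C \<subseteq> snd C' \<longrightarrow> C' = C)"

definition conn_subgraph :: "'a set \<Rightarrow> ('a \<Rightarrow> 'a \<Rightarrow> real) \<Rightarrow> 'a \<Rightarrow> 'a
    \<Rightarrow> 'a set \<times> ('a \<times> 'a) set" where
  "conn_subgraph V w k j = (THE C. is_conn_subgraph V w k j C)"

text \<open>Restriction of the weights to the edge set F.\<close>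
definition restrict_w :: "('a \<Rightarrow> 'a \<Rightarrow> real) \<Rightarrow> ('a \<times> 'a) set \<Rightarrow> 'a \<Rightarrow> 'a \<Rightarrow> real" where
  "restrict_w w F u v = (if (u, v) \<in> F then w u v else 0)"

text \<open>r_{k,j} in G: effective resistance computed in the connection subgraph.\<close>
definition resistance :: "'a set \<Rightarrow> ('a \<Rightarrow> 'a \<Rightarrow> real) \<Rightarrow> 'a \<Rightarrow> 'a \<Rightarrow> real" where
  "resistance V w k j =
     (let C = conn_subgraph V w k j in eff_res (fst C) (restrict_w w (snd C)) k j)"

text \<open>Directed tree: underlying undirected graph is a tree, all edges directed towards
  a root r: r has no outgoing edge, every other node exactly one, and every node reaches r.\<close>
definition directed_tree :: "'a set \<Rightarrow> ('a \<times> 'a) set \<Rightarrow> bool" where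
  "directed_tree S F \<longleftrightarrow> F \<subseteq> S \<times> S \<and>
     (\<exists>r\<in>S. (\<forall>v. (r, v) \<notin> F) \<and>
        (\<forall>u\<in>S - {r}. \<exists>!v. (u, v) \<in> F) \<and>
        (\<forall>u\<in>S. (u, r) \<in> F\<^sup>*))"

text \<open>Length of a shortest directed path from k to a node reachable from both k and j.\<close>
definition short_len :: "('a \<times> 'a) set \<Rightarrow> 'a \<Rightarrow> 'a \<Rightarrow> nat" where
  "short_len E k j = (LEAST l. \<exists>p. dpath E p \<and> hd p = k \<and> length p = Suc l \<and>
       (k, last p) \<in> E\<^sup>* \<and> (j, last p) \<in> E\<^sup>*)"

end

theory Submission
  imports Defs
begin

text \<open>By uniqueness, the connection subgraph contains every connection, so it consists of the paths of
  \<open>k\<close> and \<open>j\<close> to the root of the tree, and \<open>n\<close>, \<open>m\<close> are the distances of \<open>k\<close>, \<open>j\<close> to the first node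
  where these paths meet.

  The Lyapunov equation says that \<open>L X + X L\<^sup>T = 2 I\<close> up to terms \<open>g v + h u\<close>. Such terms and the
  projection onto the complement of the constant vectors do not affect the resistance, so \<open>X\<close> may be
  replaced by the matrix \<open>Z\<close> vanishing in the row and column of the root. On a tree with parent function
  \<open>p\<close> the equation becomes \<open>2 Z u v = Z (p u) v + Z u (p v) + 2 + 2 [u = v]\<close>, which has exactly one
  solution by induction on the depths. If \<open>u\<close> is an ancestor of \<open>v\<close>, then \<open>Z u v\<close> is twice the depth
  of \<open>u\<close>. Hence the resistance \<open>f n m\<close> satisfies \<open>f n 0 = 2 n\<close>, \<open>f 0 m = 2 m\<close> and
  \<open>2 f n m = f (n - 1) m + f n (m - 1)\<close>, and by Pascal's rule so does the closed form.\<close>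

section \<open>The Lyapunov equation\<close>

text \<open>The product \<open>Q A Q\<^sup>T\<close>: the shape of \<open>reduced_laplacian\<close>,
  for an arbitrary matrix \<open>A\<close>.\<close>

definition sandwich :: "'a set \<Rightarrow> (nat \<Rightarrow> 'a \<Rightarrow> real) \<Rightarrow> ('a \<Rightarrow> 'a \<Rightarrow> real) \<Rightarrow> nat \<Rightarrow> nat \<Rightarrow> real" where
  "sandwich S Q A p q = (\<Sum>u\<in>S. \<Sum>v\<in>S. Q p u * A u v * Q q v)"

text \<open>The rows of \<open>Q\<close> are those of a Householder reflection exchanging \<open>\<one>/\<surd>N\<close> with, up to sign,
  the unit vector at \<open>s0\<close>; this gives the constants \<open>b\<close> and \<open>c\<close>.\<close>
lemma valid_Q_exists:
  assumes "finite S" "S \<noteq> {}"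
  shows "\<exists>Q. valid_Q S Q"
proof -
  obtain s0 where s0: "s0 \<in> S" using assms by auto
  define M where "M = card S - 1"
  have cM: "card (S - {s0}) = M" using assms s0 by (simp add: M_def)
  obtain e where e: "bij_betw e {..<M} (S - {s0})"
    using ex_bij_betw_nat_finite[of "S - {s0}"] assms cM by (auto simp: atLeast0LessThan)
  define x where "x = inv_into {..<M} e"
  have cS: "card S = Suc M" using assms s0 cM by (metis card_Suc_Diff1)
  define c where "c = 1 / sqrt (real (Suc M))"
  define b where "b = (1 - c) / real M"
  have c2: "c * c = 1 / real (Suc M)" by (simp add: c_def)
  have Mb: "real M * b = 1 - c" if "M > 0" using that by (simp add: b_def)
  have bb: "2 * b - real M * b * b = c * c" if "M > 0"
  proof -
    have "real M * (2 * b - real M * b * b) = (1 - c) * (2 - (1 - c))"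
      using Mb[OF that] by algebra
    also have "\<dots> = 1 - c * c" by algebra
    also have "\<dots> = real M * (c * c)" unfolding c2 by (simp add: field_simps)
    finally show ?thesis using that by simp
  qed
  define Q where "Q p u = (if u = s0 then - c else (if u = e p then 1 else 0) - b)" for p u
  have S_eq: "S = insert s0 (e ` {..<M})" using e s0 by (auto simp: bij_betw_def)
  have inj: "inj_on e {..<M}" using e by (auto simp: bij_betw_def)
  have ne: "e q \<noteq> s0" if "q < M" for q using e that by (auto simp: bij_betw_def)
  have sumS: "(\<Sum>u\<in>S. f u) = f s0 + (\<Sum>q<M. f (e q))" for f :: "'a \<Rightarrow> real"
  proof -
    have "s0 \<notin> e ` {..<M}" using ne by auto
    then show ?thesis unfolding S_eq by (simp add: sum.reindex[OF inj])
  qed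
  have Qe: "Q p (e q) = (if p = q then 1 else 0) - b" if "p < M" "q < M" for p q
    using that ne inj by (auto simp: Q_def inj_on_eq_iff)
  have Qs: "Q p s0 = - c" for p by (simp add: Q_def)
  have 1: "(\<Sum>u\<in>S. Q p u) = 0" if "p < M" for p
  proof -
    have "(\<Sum>u\<in>S. Q p u) = - c + (\<Sum>q<M. (if p = q then 1 else 0) - b)"
      unfolding sumS Qs using Qe that by (intro arg_cong2[where f="(+)"] sum.cong) auto
    also have "\<dots> = 0" using Mb that by (simp add: sum_subtractf)
    finally show ?thesis .
  qed
  \<comment> \<open>Away from \<open>s0\<close> the block of \<open>Q\<close> is square and
    symmetric, so one product serves rows and columns alike.\<close>
  have key: "(\<Sum>s<M. ((if p = s then 1 else 0) - b) * ((if q = s then 1 else 0) - b))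
     = (if p = q then 1 else 0) - c * c" if "p < M" "q < M" for p q
  proof -
    have "(\<Sum>s<M. ((if p = s then 1 else 0) - b) * ((if q = s then 1 else 0) - b)) =
       (\<Sum>s<M. (if p = s then (if q = p then 1 else 0) else 0) - (if p = s then b else 0)
          - (if q = s then b else 0) + b * b)"
      by (intro sum.cong) (auto simp: algebra_simps)
    also have "\<dots> = (if p = q then 1 else 0) - (2 * b - real M * b * b)"
      using that by (simp add: sum.distrib sum_subtractf)
    finally show ?thesis using bb that by simp
  qed
  have 2: "(\<Sum>u\<in>S. Q p u * Q q u) = (if p = q then 1 else 0)" if "p < M" "q < M" for p q
  proof -
    have "(\<Sum>u\<in>S. Q p u * Q q u) = c * c + (\<Sum>s<M. ((if p = s then 1 else 0) - b) * ((if q = s then 1 else 0) - b))"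
      unfolding sumS Qs using Qe that by (intro arg_cong2[where f="(+)"] sum.cong) auto
    then show ?thesis using key[OF that] by simp
  qed
  have 3: "(\<Sum>p<M. Q p u * Q p v) = (if u = v then 1 else 0) - c * c" if uv: "u \<in> S" "v \<in> S" for u v
  proof -
    have ss: "(\<Sum>p<M. Q p s0 * Q p s0) = 1 - c * c" unfolding Qs c2 by (simp add: c2 field_simps)
    have se: "(\<Sum>p<M. Q p s0 * Q p (e q)) = - (c * c)" if "q < M" for q
    proof -
      have "(\<Sum>p<M. Q p s0 * Q p (e q)) = (\<Sum>p<M. - c * ((if p = q then 1 else 0) - b))"
        unfolding Qs using Qe that by (intro sum.cong) auto
      also have "\<dots> = - c * (1 - real M * b)"
        using that by (subst sum_distrib_left[symmetric]) (simp add: sum_subtractf)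
      finally show ?thesis using Mb that by simp
    qed
    have ee: "(\<Sum>p<M. Q p (e q) * Q p (e q')) = (if q = q' then 1 else 0) - c * c"
      if "q < M" "q' < M" for q q'
    proof -
      have "(\<Sum>p<M. Q p (e q) * Q p (e q')) = (\<Sum>s<M. ((if q = s then 1 else 0) - b) * ((if q' = s then 1 else 0) - b))"
        using Qe that by (intro sum.cong) auto
      then show ?thesis using key that by simp
    qed
    consider "u = s0" "v = s0" | q where "u = s0" "v = e q" "q < M" | q where "v = s0" "u = e q" "q < M"
      | q q' where "u = e q" "v = e q'" "q < M" "q' < M"
      using uv S_eq by blast
    then show ?thesis
    proof cases
      case 1 then show ?thesis using ss by simp
    next
      case 2 then show ?thesis using se[of q] ne[of q] by auto
    next
      case 3 then show ?thesis using se[of q] ne[of q] by (auto simp: mult.commute)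
    next
      case 4 then show ?thesis using ee inj by (simp add: inj_on_eq_iff)
    qed
  qed
  have "valid_Q S Q"
    unfolding valid_Q_def M_def[symmetric] cS using 1 2 3 c2 by auto
  then show ?thesis by blast
qed

section \<open>Compression by \<open>Q\<close> and its inversion\<close>

locale projection =
  fixes S :: "'a set" and Q :: "nat \<Rightarrow> 'a \<Rightarrow> real" and M :: nat
  assumes fin: "finite S" and valid: "valid_Q S Q" and M_eq: "M = card S - 1"
begin

lemma Q_sum: "p < M \<Longrightarrow> (\<Sum>u\<in>S. Q p u) = 0"
  and Q_row: "p < M \<Longrightarrow> q < M \<Longrightarrow> (\<Sum>u\<in>S. Q p u * Q q u) = (if p = q then 1 else 0)"
  and Q_col: "u \<in> S \<Longrightarrow> v \<in> S \<Longrightarrow>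
    (\<Sum>p<M. Q p u * Q p v) = (if u = v then 1 else 0) - 1 / real (card S)"
  using valid by (auto simp: valid_Q_def M_eq)

text \<open>\<open>Q\<^sup>T Q\<close> is the orthogonal projection along the constant vectors, so
  it subtracts the mean.\<close>

lemma Q_centre:
  assumes "u \<in> S"
  shows "(\<Sum>p<M. Q p u * (\<Sum>x\<in>S. Q p x * f x)) = f u - (\<Sum>x\<in>S. f x) / real (card S)"
proof -
  have "(\<Sum>p<M. Q p u * (\<Sum>x\<in>S. Q p x * f x)) = (\<Sum>p<M. \<Sum>x\<in>S. (Q p u * Q p x) * f x)"
    by (simp add: sum_distrib_left mult.assoc)
  also have "\<dots> = (\<Sum>x\<in>S. (\<Sum>p<M. Q p u * Q p x) * f x)"
    by (subst sum.swap) (simp add: sum_distrib_right)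
  also have "\<dots> = (\<Sum>x\<in>S. (if x = u then f x else 0) - f x / real (card S))"
    using assms by (intro sum.cong) (auto simp: Q_col algebra_simps)
  also have "\<dots> = f u - (\<Sum>x\<in>S. f x) / real (card S)"
    using assms fin by (simp add: sum_subtractf sum_divide_distrib)
  finally show ?thesis .
qed

lemma Q_dual:
  assumes "p < M"
  shows "(\<Sum>u\<in>S. Q p u * (\<Sum>q<M. Q q u * c q)) = c p"
proof -
  have "(\<Sum>u\<in>S. Q p u * (\<Sum>q<M. Q q u * c q)) = (\<Sum>u\<in>S. \<Sum>q<M. (Q p u * Q q u) * c q)"
    by (simp add: sum_distrib_left mult.assoc)
  also have "\<dots> = (\<Sum>q<M. (\<Sum>u\<in>S. Q p u * Q q u) * c q)"
    by (subst sum.swap) (simp add: sum_distrib_right)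
  also have "\<dots> = (\<Sum>q<M. if q = p then c q else 0)"
    using assms by (intro sum.cong) (auto simp: Q_row)
  also have "\<dots> = c p" using assms by simp
  finally show ?thesis .
qed

lemma sandwich_nested: "sandwich S Q A p q = (\<Sum>u\<in>S. Q p u * (\<Sum>v\<in>S. Q q v * A u v))"
  by (simp add: sandwich_def sum_distrib_left mult_ac)

lemma sandwich_add: "sandwich S Q (\<lambda>u v. A u v + B u v) p q = sandwich S Q A p q + sandwich S Q B p q"
  by (simp add: sandwich_def algebra_simps sum.distrib)

lemma sandwich_transpose: "sandwich S Q (\<lambda>u v. A v u) p q = sandwich S Q A q p"
  unfolding sandwich_def by (subst sum.swap) (simp add: mult_ac)

lemma sandwich_cong:
  "(\<And>u v. u \<in> S \<Longrightarrow> v \<in> S \<Longrightarrow> A u v = B u v) \<Longrightarrow> sandwich S Q A p q = sandwich S Q B p q"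
  by (auto simp: sandwich_def intro!: sum.cong)

text \<open>Each summand is constant in one index, and \<open>Q\<close> annihilates constants on
  that side.\<close>

lemma sandwich_rank_one:
  assumes "p < M" "q < M"
  shows "sandwich S Q (\<lambda>u v. g v + h u) p q = 0"
proof -
  have "sandwich S Q (\<lambda>u v. g v + h u) p q = sandwich S Q (\<lambda>u v. g v) p q + sandwich S Q (\<lambda>u v. h u) p q"
    by (rule sandwich_add)
  moreover have "sandwich S Q (\<lambda>u v. g v) p q = 0"
    using Q_sum[OF assms(1)] by (simp add: sandwich_nested sum_distrib_right[symmetric])
  moreover have "sandwich S Q (\<lambda>u v. h u) p q = 0"
    using Q_sum[OF assms(2)] by (simp add: sandwich_nested sum_distrib_right[symmetric])
  ultimately show ?thesis by simp
qed

lemma sandwich_identity: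
  assumes "p < M" "q < M"
  shows "sandwich S Q (\<lambda>u v. if u = v then c else 0) p q = (if p = q then c else 0)"
proof -
  have "sandwich S Q (\<lambda>u v. if u = v then c else 0) p q = (\<Sum>u\<in>S. Q p u * Q q u) * c"
    using fin by (simp add: sandwich_nested if_distrib mult.assoc sum_distrib_right cong: if_cong)
  then show ?thesis using assms by (simp add: Q_row)
qed

text \<open>Since the rows of L sum to zero, \<open>L Q\<^sup>T Q = L\<close>.\<close>
lemma sandwich_mult:
  assumes L: "\<And>u. u \<in> S \<Longrightarrow> (\<Sum>v\<in>S. L u v) = 0"
  shows "(\<Sum>s<M. sandwich S Q L p s * sandwich S Q A s q) = sandwich S Q (\<lambda>u v. \<Sum>x\<in>S. L u x * A x v) p q"
proof -
  define B where "B x = (\<Sum>y\<in>S. Q q y * A x y)" for x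
  have "(\<Sum>s<M. sandwich S Q L p s * sandwich S Q A s q) =
     (\<Sum>s<M. \<Sum>u\<in>S. \<Sum>v\<in>S. Q p u * L u v * (Q s v * (\<Sum>x\<in>S. Q s x * B x)))"
    unfolding sandwich_nested B_def[symmetric] by (simp add: sum_distrib_left sum_distrib_right mult_ac)
  also have "\<dots> = (\<Sum>u\<in>S. \<Sum>v\<in>S. \<Sum>s<M. Q p u * L u v * (Q s v * (\<Sum>x\<in>S. Q s x * B x)))"
    by (subst sum.swap) (intro sum.cong refl sum.swap)
  also have "\<dots> = (\<Sum>u\<in>S. \<Sum>v\<in>S. Q p u * L u v * (B v - (\<Sum>x\<in>S. B x) / real (card S)))"
    by (intro sum.cong refl) (simp add: sum_distrib_left[symmetric] Q_centre)
  also have "\<dots> = (\<Sum>u\<in>S. Q p u * (\<Sum>v\<in>S. L u v * B v) - Q p u * (\<Sum>v\<in>S. L u v) * ((\<Sum>x\<in>S. B x) / real (card S)))"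
    by (intro sum.cong refl)
      (simp only: right_diff_distrib sum_subtractf sum_distrib_left[symmetric] sum_distrib_right[symmetric] mult.assoc)
  also have "\<dots> = (\<Sum>u\<in>S. Q p u * (\<Sum>v\<in>S. L u v * B v))"
    using L by (intro sum.cong refl) simp
  also have "\<dots> = (\<Sum>u\<in>S. Q p u * (\<Sum>y\<in>S. Q q y * (\<Sum>x\<in>S. L u x * A x y)))"
  proof -
    have "(\<Sum>v\<in>S. L u v * B v) = (\<Sum>y\<in>S. Q q y * (\<Sum>x\<in>S. L u x * A x y))" for u
      unfolding B_def sum_distrib_left by (subst sum.swap) (simp add: mult_ac)
    then show ?thesis by simp
  qed
  also have "\<dots> = sandwich S Q (\<lambda>u v. \<Sum>x\<in>S. L u x * A x v) p q"
    unfolding sandwich_nested ..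
  finally show ?thesis .
qed

text \<open>Compressing and expanding again gives \<open>\<Pi> W \<Pi>\<close>, computed by applying
  \<open>Q_centre\<close> once in each index.\<close>

lemma unsandwich:
  assumes "u \<in> S" "v \<in> S"
  shows "(\<Sum>p<M. \<Sum>q<M. Q p u * sandwich S Q W p q * Q q v) =
    W u v - (\<Sum>y\<in>S. W u y) / real (card S)
      - (\<Sum>x\<in>S. W x v - (\<Sum>y\<in>S. W x y) / real (card S)) / real (card S)"
proof -
  have inner: "(\<Sum>q<M. Q q v * sandwich S Q W p q) =
      (\<Sum>x\<in>S. Q p x * (W x v - (\<Sum>y\<in>S. W x y) / real (card S)))" for p
  proof -
    have "(\<Sum>q<M. Q q v * sandwich S Q W p q) =
       (\<Sum>q<M. \<Sum>x\<in>S. Q p x * (Q q v * (\<Sum>y\<in>S. Q q y * W x y)))"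
      unfolding sandwich_nested by (simp add: sum_distrib_left mult_ac)
    also have "\<dots> = (\<Sum>x\<in>S. Q p x * (\<Sum>q<M. Q q v * (\<Sum>y\<in>S. Q q y * W x y)))"
      by (subst sum.swap) (simp add: sum_distrib_left)
    finally show ?thesis using assms by (simp add: Q_centre)
  qed
  have "(\<Sum>p<M. \<Sum>q<M. Q p u * sandwich S Q W p q * Q q v) =
      (\<Sum>p<M. Q p u * (\<Sum>q<M. Q q v * sandwich S Q W p q))"
    by (simp add: sum_distrib_left mult_ac)
  then show ?thesis unfolding inner using assms by (simp only: Q_centre)
qed

text \<open>Since \<open>Q Q\<^sup>T = I\<close>, every matrix of size \<open>M\<close> is the
  compression of its expansion. This moves the uniqueness of \<Sigma> to matrices over
  \<open>S\<close>.\<close>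

lemma sandwich_unsandwich:
  assumes "p < M" "q < M"
  shows "sandwich S Q (\<lambda>u v. \<Sum>p<M. \<Sum>q<M. Q p u * D p q * Q q v) p q = D p q"
proof -
  have "(\<Sum>v\<in>S. Q q v * (\<Sum>p<M. \<Sum>q<M. Q p u * D p q * Q q v)) = (\<Sum>p'<M. Q p' u * D p' q)" for u
  proof -
    have "(\<Sum>p<M. \<Sum>q<M. Q p u * D p q * Q q v) = (\<Sum>q<M. Q q v * (\<Sum>p<M. Q p u * D p q))" for v
      unfolding sum_distrib_left by (subst sum.swap) (simp add: mult_ac)
    then show ?thesis using assms by (simp add: Q_dual)
  qed
  then show ?thesis using assms by (simp add: sandwich_nested Q_dual)
qed

end

lemma laplacian_row_sum:
  assumes "finite S" "u \<in> S"
  shows "(\<Sum>v\<in>S. laplacian S a u v) = 0"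
  using assms by (simp add: laplacian_def sum_subtractf)

text \<open>Passing from \<open>X\<close> to \<open>Z\<close> only changes the matrix by terms \<open>g v + h u\<close>, which neither the
  Lyapunov equation compressed by \<open>Q\<close> nor the resistance sees.\<close>
lemma eff_res_eqI:
  fixes Z :: "'a \<Rightarrow> 'a \<Rightarrow> real"
  assumes fin: "finite S" and k: "k \<in> S" and j: "j \<in> S"
    and sym: "\<And>u v. u \<in> S \<Longrightarrow> v \<in> S \<Longrightarrow> Z u v = Z v u"
    and sol: "\<And>u v. u \<in> S \<Longrightarrow> v \<in> S \<Longrightarrow>
      (\<Sum>x\<in>S. laplacian S a u x * Z x v) + (\<Sum>x\<in>S. laplacian S a v x * Z u x)
        = (if u = v then 2 else 0) + (g v + h u)"
    and uniq: "\<And>Y g h u v u' v'. (\<And>u v. u \<in> S \<Longrightarrow> v \<in> S \<Longrightarrow>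
      (\<Sum>x\<in>S. laplacian S a u x * Y x v) + (\<Sum>x\<in>S. laplacian S a v x * Y u x) = g v + h u) \<Longrightarrow>
      u \<in> S \<Longrightarrow> v \<in> S \<Longrightarrow> u' \<in> S \<Longrightarrow> v' \<in> S \<Longrightarrow> Y u v - Y u' v - Y u v' + Y u' v' = 0"
  shows "eff_res S a k j = Z k k + Z j j - 2 * Z k j"
proof -
  define Q where "Q = (SOME Q. valid_Q S Q)"
  have "valid_Q S Q" unfolding Q_def using valid_Q_exists[of S] fin k by (metis empty_iff someI_ex)
  moreover define M where "M = card S - 1"
  ultimately interpret projection S Q M using fin by unfold_locales
  define L where "L = laplacian S a"
  define R where "R = reduced_laplacian S a Q"
  have R: "R = sandwich S Q L" by (simp add: R_def L_def fun_eq_iff reduced_laplacian_def sandwich_def)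
  have L0: "(\<Sum>v\<in>S. L u v) = 0" if "u \<in> S" for u
    using laplacian_row_sum[OF fin that] by (simp add: L_def)
  \<comment> \<open>The second sum is the transpose of a product covered by
    \<open>sandwich_mult\<close>, so the Lyapunov operator commutes with compression.\<close>
  have lyap: "(\<Sum>s<M. R p s * sandwich S Q A s q) + (\<Sum>s<M. sandwich S Q A p s * R q s)
     = sandwich S Q (\<lambda>u v. (\<Sum>x\<in>S. L u x * A x v) + (\<Sum>x\<in>S. L v x * A u x)) p q" for A p q
  proof -
    have "(\<Sum>s<M. sandwich S Q A p s * R q s) = (\<Sum>s<M. R q s * sandwich S Q (\<lambda>u v. A v u) s p)"
      by (simp add: sandwich_transpose[of A] mult.commute)
    also have "\<dots> = sandwich S Q (\<lambda>u v. \<Sum>x\<in>S. L u x * A v x) q p"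
      unfolding R using sandwich_mult[OF L0] by simp
    also have "\<dots> = sandwich S Q (\<lambda>u v. \<Sum>x\<in>S. L v x * A u x) p q"
      by (rule sandwich_transpose[symmetric])
    finally show ?thesis unfolding sandwich_add using sandwich_mult[OF L0] R by simp
  qed
  \<comment> \<open>The half offsets the factor 2 in \<open>Xmat\<close>; the zeros outside are
    demanded by \<open>lyap_sol\<close>.\<close>
  define T where "T p q = (if p < M \<and> q < M then sandwich S Q Z p q / 2 else 0)" for p q
  have T: "lyap_sol S a Q T"
    unfolding lyap_sol_def R_def[symmetric] M_def[symmetric]
  proof (intro conjI allI impI)
    fix p q assume p: "p < M" and q: "q < M"
    have "(\<Sum>s<M. R p s * T s q) + (\<Sum>s<M. T p s * R q s) =
       ((\<Sum>s<M. R p s * sandwich S Q Z s q) + (\<Sum>s<M. sandwich S Q Z p s * R q s)) / 2"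
      using p q by (simp add: T_def sum_divide_distrib add_divide_distrib)
    also have "\<dots> = sandwich S Q (\<lambda>u v. (if u = v then 2 else 0) + (g v + h u)) p q / 2"
      unfolding lyap by (intro arg_cong2[where f="(/)"] sandwich_cong refl) (use sol in \<open>simp add: L_def\<close>)
    also have "\<dots> = (if p = q then 1 else 0)"
      using p q by (simp add: sandwich_add[of "\<lambda>u v. if u = v then 2 else 0" "\<lambda>u v. g v + h u"] sandwich_identity sandwich_rank_one)
    finally show "(\<Sum>s<M. R p s * T s q) + (\<Sum>s<M. T p s * R q s) = (if p = q then 1 else 0)" .
  next
    fix p q assume "M \<le> p \<or> M \<le> q"
    then show "T p q = 0" by (auto simp: T_def)
  qed
  \<comment> \<open>The difference of two solutions expands to \<open>Y\<close>. The equation for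
    \<open>Y\<close> compresses to zero, so over \<open>S\<close> only means remain, a right-hand
    side of the form \<open>g v + h u\<close>. Then \<open>uniq\<close> gives \<open>Y\<close> that
    form too, and its compression \<open>D\<close> vanishes.\<close>
  have T_unique: "T' = T" if T': "lyap_sol S a Q T'" for T'
  proof -
    define D where "D p q = T' p q - T p q" for p q
    define Y where "Y u v = (\<Sum>p<M. \<Sum>q<M. Q p u * D p q * Q q v)" for u v
    have YD: "sandwich S Q Y p q = D p q" if "p < M" "q < M" for p q
      unfolding Y_def using sandwich_unsandwich[OF that] .
    define W where "W u v = (\<Sum>x\<in>S. L u x * Y x v) + (\<Sum>x\<in>S. L v x * Y u x)" for u v
    have W0: "sandwich S Q W p q = 0" if "p < M" "q < M" for p q
    proof -
      have "sandwich S Q W p q = (\<Sum>s<M. R p s * sandwich S Q Y s q) + (\<Sum>s<M. sandwich S Q Y p s * R q s)"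
        unfolding lyap W_def ..
      also have "\<dots> = (\<Sum>s<M. R p s * D s q) + (\<Sum>s<M. D p s * R q s)"
        using that YD by simp
      also have "\<dots> = ((\<Sum>s<M. R p s * T' s q) + (\<Sum>s<M. T' p s * R q s)) - ((\<Sum>s<M. R p s * T s q) + (\<Sum>s<M. T p s * R q s))"
        by (simp add: D_def algebra_simps sum_subtractf)
      also have "\<dots> = 0" using T T' that by (simp add: lyap_sol_def R_def M_def)
      finally show ?thesis .
    qed
    have Weq: "W u v = (\<Sum>x\<in>S. W x v - (\<Sum>y\<in>S. W x y) / real (card S)) / real (card S)
        + (\<Sum>y\<in>S. W u y) / real (card S)" if "u \<in> S" "v \<in> S" for u v
      using unsandwich[OF that, of W] W0 by simp
    have Y0: "Y u v - Y k v - Y u k + Y k k = 0" if "u \<in> S" "v \<in> S" for u v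
    proof (rule uniq)
      show "(\<Sum>x\<in>S. laplacian S a u x * Y x v) + (\<Sum>x\<in>S. laplacian S a v x * Y u x) =
         (\<Sum>x\<in>S. W x v - (\<Sum>y\<in>S. W x y) / real (card S)) / real (card S)
        + (\<Sum>y\<in>S. W u y) / real (card S)" if "u \<in> S" "v \<in> S" for u v
        using Weq[OF that] by (simp only: W_def L_def)
    qed (use that k in auto)
    have "D p q = 0" if "p < M" "q < M" for p q
    proof -
      have "D p q = sandwich S Q (\<lambda>u v. Y k v + (Y u k - Y k k)) p q"
        unfolding YD[OF that, symmetric] by (rule sandwich_cong) (use Y0 in force)
      also have "\<dots> = 0" using that by (rule sandwich_rank_one)
      finally show ?thesis .
    qed
    moreover have "D p q = 0" if "\<not> (p < M \<and> q < M)" for p q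
      using that T T' by (auto simp: lyap_sol_def D_def M_def not_less)
    ultimately have "D p q = 0" for p q by blast
    then show ?thesis by (simp add: D_def fun_eq_iff)
  qed
  have "(THE T. lyap_sol S a Q T) = T" using T T_unique by blast
  then have X: "Xmat S a u v = (\<Sum>p<M. \<Sum>q<M. Q p u * sandwich S Q Z p q * Q q v)" for u v
    unfolding Xmat_def Q_def[symmetric] M_def[symmetric] Let_def by (simp add: T_def sum_distrib_left)
  \<comment> \<open>By symmetry the row and column means of \<open>Z\<close> agree, so the centring
    terms cancel in the resistance.\<close>
  have "(\<Sum>y\<in>S. Z y u) = (\<Sum>y\<in>S. Z u y)" if "u \<in> S" for u
    using sym that by (intro sum.cong) auto
  then show ?thesis
    unfolding eff_res_def X using k j sym[OF k j] by (simp add: unsandwich sum_subtractf diff_divide_distrib)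
qed

section \<open>The closed form\<close>

text \<open>The exponent can be negative, hence \<open>powi\<close>.\<close>

definition tree_res :: "nat \<Rightarrow> nat \<Rightarrow> real" where
  "tree_res n m = 2 * (real n - real m) + (2::real) powi (3 - int n - int m) *
       (\<Sum>i = 1..(m + 1) div 2. real i * real ((n + m + 2) choose (n + 2 * i + 1)))"

text \<open>Beyond the bound the lower index of the binomial exceeds the upper one. A larger bound
  frees the recursion from the parity of \<open>m\<close>.\<close>

lemma tree_res_sum_extend:
  assumes "(m + 1) div 2 \<le> K"
  shows "(\<Sum>i = 1..(m + 1) div 2. real i * real ((n + m + 2) choose (n + 2 * i + 1)))
    = (\<Sum>i = 1..K. real i * real ((n + m + 2) choose (n + 2 * i + 1)))"
proof (rule sum.mono_neutral_left)
  show "\<forall>i\<in>{1..K} - {1..(m + 1) div 2}. real i * real ((n + m + 2) choose (n + 2 * i + 1)) = 0"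
  proof
    fix i assume "i \<in> {1..K} - {1..(m + 1) div 2}"
    then have "n + m + 2 < n + 2 * i + 1" by auto
    then show "real i * real ((n + m + 2) choose (n + 2 * i + 1)) = 0"
      by (simp only: binomial_eq_0 of_nat_0 mult_zero_right)
  qed
qed (use assms in auto)

lemma tree_res_0_right: "tree_res n 0 = 2 * real n"
  by (simp add: tree_res_def)

text \<open>Write \<open>i\<close> as half of \<open>(2 i + 1) - 1\<close>; a sum over odd indices is half the difference of the
  plain and the alternating sum.\<close>
lemma sum_odd_binomial:
  "(\<Sum>i = 1..Suc m. real i * real ((m + 2) choose (2 * i + 1))) = real m * 2 ^ m / 2"
proof -
  let ?M = "m + 2"
  define f where "f l = (1 - (-1) ^ l) * (real l - 1) * real (?M choose l)" for l
  have pairs: "(\<Sum>l<2 * K. f l) = (\<Sum>i<K. f (2 * i) + f (2 * i + 1))" for K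
    by (induction K) auto
  \<comment> \<open>\<open>f\<close> vanishes at even arguments and at 1, and
    \<open>f (2 * i + 1)\<close> is \<open>4 * i\<close> times the binomial. Hence the factor 4, and
    the sum may start at 0.\<close>
  have "4 * (\<Sum>i = 1..Suc m. real i * real (?M choose (2 * i + 1))) =
      (\<Sum>i = 1..Suc m. f (2 * i) + f (2 * i + 1))"
    unfolding sum_distrib_left by (intro sum.cong) (auto simp: f_def)
  also have "\<dots> = (\<Sum>i<?M. f (2 * i) + f (2 * i + 1))"
    by (intro sum.mono_neutral_left) (auto simp: f_def)
  also have "\<dots> = (\<Sum>l\<le>?M. f l)"
    unfolding pairs[symmetric] by (intro sum.mono_neutral_right) (auto simp: f_def binomial_eq_0)
  also have "\<dots> = real (\<Sum>l\<le>?M. l * (?M choose l)) - real (\<Sum>l\<le>?M. ?M choose l)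
      - (\<Sum>l\<le>?M. (-1) ^ l * of_nat l * of_nat (?M choose l)) + (\<Sum>l\<le>?M. (-1) ^ l * of_nat (?M choose l))"
    unfolding f_def of_nat_sum sum_subtractf[symmetric] sum.distrib[symmetric]
    by (intro sum.cong) (auto simp: algebra_simps)
  \<comment> \<open>Both alternating sums vanish because \<open>?M\<close> is at least 2.\<close>
  also have "\<dots> = real (?M * 2 ^ (?M - 1)) - real (2 ^ ?M)"
    using choose_linear_sum[of ?M] choose_row_sum[of ?M] choose_alternating_linear_sum[of ?M, where 'a = real]
      choose_alternating_sum[of ?M, where 'a = real] by simp
  finally show ?thesis by (simp add: algebra_simps)
qed

lemma tree_res_0_left: "tree_res 0 m = 2 * real m"
proof -
  have sum: "(\<Sum>i = 1..(m + 1) div 2. real i * real ((0 + m + 2) choose (0 + 2 * i + 1))) = real m * 2 ^ m / 2"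
    using tree_res_sum_extend[of m "Suc m" 0] sum_odd_binomial[of m] by simp
  show ?thesis unfolding tree_res_def sum by (simp add: power_int_diff)
qed

text \<open>Pascal's rule adds the two sums term by term. Lowering either argument doubles the power
  of 2, which absorbs the halving, and the linear part equals the average of its two
  neighbours.\<close>

lemma tree_res_Suc_Suc:
  "tree_res (Suc n) (Suc m) = (tree_res n (Suc m) + tree_res (Suc n) m) / 2"
proof -
  define s where "s n m = (\<Sum>i = 1..Suc m. real i * real ((n + m + 2) choose (n + 2 * i + 1)))" for n m
  have res: "tree_res n m = 2 * (real n - real m) + (2::real) powi (3 - int n - int m) * s n m" for n m
    unfolding tree_res_def s_def using tree_res_sum_extend[of m "Suc m" n] by simp
  \<comment> \<open>The upper limit \<open>Suc (Suc m)\<close> is the one of the other two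
    sums.\<close>
  have "s (Suc n) m = (\<Sum>i = 1..Suc (Suc m). real i * real ((Suc n + m + 2) choose (Suc n + 2 * i + 1)))"
    unfolding s_def using tree_res_sum_extend[of m "Suc m" "Suc n"] tree_res_sum_extend[of m "Suc (Suc m)" "Suc n"] by simp
  then have "s (Suc n) (Suc m) = s n (Suc m) + s (Suc n) m"
    by (simp add: s_def sum.distrib[symmetric] algebra_simps)
  moreover have "(2::real) powi (3 - int (Suc n) - int m) = 2 * 2 powi (3 - int (Suc n) - int (Suc m))"
    "(2::real) powi (3 - int n - int (Suc m)) = 2 * 2 powi (3 - int (Suc n) - int (Suc m))"
    using power_int_add_1[of "2::real" "3 - int (Suc n) - int (Suc m)"] by (simp_all add: algebra_simps)
  ultimately show ?thesis unfolding res by (simp add: algebra_simps)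
qed

section \<open>Rooted trees\<close>

text \<open>Making \<open>r\<close> a fixed point of \<open>par\<close> keeps iterates past the
  depth at the root.\<close>

locale rooted_tree =
  fixes S :: "'a set" and r :: 'a and par :: "'a \<Rightarrow> 'a"
  assumes finite_S: "finite S" and root: "r \<in> S"
    and par_in: "u \<in> S \<Longrightarrow> par u \<in> S" and par_root: "par r = r"
    and reaches: "u \<in> S \<Longrightarrow> \<exists>l. (par ^^ l) u = r"
begin

definition depth :: "'a \<Rightarrow> nat" where
  "depth u = (LEAST l. (par ^^ l) u = r)"

lemma par_pow_in: "u \<in> S \<Longrightarrow> (par ^^ l) u \<in> S"
  by (induction l) (auto simp: par_in)

lemma par_pow_root: "(par ^^ l) r = r"
  by (induction l) (auto simp: par_root)

lemma par_pow_depth: "u \<in> S \<Longrightarrow> (par ^^ depth u) u = r"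
  unfolding depth_def by (rule LeastI_ex) (rule reaches)

lemma depth_eq_0_iff: "u \<in> S \<Longrightarrow> depth u = 0 \<longleftrightarrow> u = r"
  using par_pow_depth[of u] Least_eq_0[of "\<lambda>l. (par ^^ l) u = r"] by (auto simp: depth_def)

lemma depth_par:
  assumes "u \<in> S" "u \<noteq> r"
  shows "depth u = Suc (depth (par u))"
proof -
  obtain l where l: "(par ^^ l) u = r" using reaches assms by blast
  show ?thesis unfolding depth_def
    using Least_Suc[of "\<lambda>l. (par ^^ l) u = r", OF l] assms by (simp add: funpow_Suc_right del: funpow.simps)
qed

lemma depth_par_pow: "u \<in> S \<Longrightarrow> depth ((par ^^ l) u) = depth u - l"
proof (induction l)
  case (Suc l)
  then show ?case
    using depth_par[OF par_pow_in[OF Suc.prems], of l] par_root depth_eq_0_iff[OF root]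
    by (cases "(par ^^ l) u = r") auto
qed simp

text \<open>The first argument is fuel; it equals the sum of the depths in every call that matters.\<close>
fun pot_fuel :: "nat \<Rightarrow> 'a \<Rightarrow> 'a \<Rightarrow> real" where
  "pot_fuel 0 u v = 0"
| "pot_fuel (Suc d) u v = (if u = r \<or> v = r then 0 else
     1 + (if u = v then 1 else 0) + (pot_fuel d (par u) v + pot_fuel d u (par v)) / 2)"

definition pot :: "'a \<Rightarrow> 'a \<Rightarrow> real" where
  "pot u v = pot_fuel (depth u + depth v) u v"

lemma pot_root: "pot r v = 0" "pot u r = 0"
proof -
  have "pot_fuel d r v = 0" "pot_fuel d u r = 0" for d by (cases d; simp)+
  then show "pot r v = 0" "pot u r = 0" by (simp_all add: pot_def)
qed

text \<open>Passing to a parent lowers the sum of the depths by exactly one, so both recursive calls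
  get the fuel that \<open>pot\<close> prescribes.\<close>

lemma pot_step:
  assumes "u \<in> S" "v \<in> S" "u \<noteq> r" "v \<noteq> r"
  shows "pot u v = 1 + (if u = v then 1 else 0) + (pot (par u) v + pot u (par v)) / 2"
  using assms by (simp add: pot_def depth_par[of u] depth_par[of v])

lemma pot_commute: "u \<in> S \<Longrightarrow> v \<in> S \<Longrightarrow> pot u v = pot v u"
proof (induction "depth u + depth v" arbitrary: u v rule: less_induct)
  case less
  show ?case
  proof (cases "u = r \<or> v = r")
    case False
    then show ?thesis
      using less.hyps[of "par u" v] less.hyps[of u "par v"] less.prems
      by (simp add: pot_step par_in depth_par[of u] depth_par[of v])
  qed (auto simp: pot_root)
qed

text \<open>With \<open>d\<close> the depth of a proper ancestor, the recursion averages
  \<open>2 * (d - 1)\<close> and \<open>2 * d\<close> and adds 1. On the diagonal both terms are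
  \<open>2 * (d - 1)\<close> by symmetry, and 2 is added.\<close>

lemma pot_ancestor: "v \<in> S \<Longrightarrow> pot ((par ^^ l) v) v = 2 * real (depth ((par ^^ l) v))"
proof (induction "depth ((par ^^ l) v) + depth v" arbitrary: l v rule: less_induct)
  case less
  let ?u = "(par ^^ l) v"
  have uS: "?u \<in> S" using less.prems par_pow_in by blast
  show ?case
  proof (cases "?u = r")
    case True
    then show ?thesis using depth_eq_0_iff[OF root] by (simp add: pot_root)
  next
    case False
    have vr: "v \<noteq> r" using False par_pow_root by auto
    have 1: "pot (par ?u) v = 2 * real (depth (par ?u))"
      using less.hyps[of "Suc l" v] less.prems depth_par[OF uS False] by simp
    show ?thesis
    proof (cases "?u = v")
      case True
      then have "pot ?u v = 2 + pot (par v) v"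
        using less.prems vr by (simp add: pot_step pot_commute par_in)
      then show ?thesis using 1 True depth_par[OF uS False] by simp
    next
      case ne: False
      then obtain l' where l: "l = Suc l'" by (cases l) auto
      then have u: "?u = (par ^^ l') (par v)" by (simp add: funpow_Suc_right del: funpow.simps)
      have "pot ?u (par v) = 2 * real (depth ?u)"
        unfolding u using less.hyps[of l' "par v"] less.prems u depth_par[OF less.prems vr] par_in by simp
      then show ?thesis
        using 1 ne less.prems False vr uS depth_par[OF uS False] by (simp add: pot_step)
    qed
  qed
qed

text \<open>The last premise makes \<open>x\<close> and \<open>y\<close> minimal. Moving either node
  to its parent keeps the meeting node and lowers one count, which matches the recursion of
  \<open>tree_res\<close>; once a count is 0, one node is an ancestor of the other.\<close>

lemma pot_meet:
  assumes "u \<in> S" "v \<in> S" "(par ^^ x) u = (par ^^ y) v" "x \<le> depth u" "y \<le> depth v"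
    and "\<And>a b. (par ^^ a) u = (par ^^ b) v \<Longrightarrow> x \<le> a \<and> y \<le> b"
  shows "pot u v = real (depth u) + real (depth v) - tree_res x y / 2"
  using assms
proof (induction "x + y" arbitrary: x y u v rule: less_induct)
  case less
  show ?case
  proof (cases x)
    case 0
    then have u: "u = (par ^^ y) v" using less.prems by simp
    have "depth u = depth v - y" unfolding u using less.prems(2) by (rule depth_par_pow)
    then show ?thesis using pot_ancestor[of v y] less.prems 0 u[symmetric] by (simp add: tree_res_0_left)
  next
    case x: (Suc x')
    show ?thesis
    proof (cases y)
      case 0
      then have v: "v = (par ^^ x) u" using less.prems by simp
      have "depth v = depth u - x" unfolding v using less.prems(1) by (rule depth_par_pow)
      then show ?thesis using pot_ancestor[of u x] less.prems 0 v[symmetric] pot_commute[of u v]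
        by (simp add: tree_res_0_right)
    next
      case y: (Suc y')
      have ur: "u \<noteq> r" using x less.prems depth_eq_0_iff[OF root] by auto
      have vr: "v \<noteq> r" using y less.prems depth_eq_0_iff[OF root] by auto
      \<comment> \<open>Equal nodes would meet after 0 steps, against \<open>x > 0\<close>; so the
        diagonal term is absent.\<close>
      have uv: "u \<noteq> v" using less.prems(6)[of 0 0] x by auto
      have "pot (par u) v = real (depth (par u)) + real (depth v) - tree_res x' y / 2"
      proof (rule less.hyps)
        fix a b assume "(par ^^ a) (par u) = (par ^^ b) v"
        then show "x' \<le> a \<and> y \<le> b"
          using less.prems(6)[of "Suc a" b] x by (simp add: funpow_Suc_right del: funpow.simps)
      qed (use less.prems x depth_par[OF _ ur] par_in in
            \<open>auto simp: funpow_Suc_right simp del: funpow.simps\<close>)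
      moreover have "pot u (par v) = real (depth u) + real (depth (par v)) - tree_res x y' / 2"
      proof (rule less.hyps)
        fix a b assume "(par ^^ a) u = (par ^^ b) (par v)"
        then show "x \<le> a \<and> y' \<le> b"
          using less.prems(6)[of a "Suc b"] y by (simp add: funpow_Suc_right del: funpow.simps)
      qed (use less.prems y depth_par[OF _ vr] par_in in
            \<open>auto simp: funpow_Suc_right simp del: funpow.simps\<close>)
      ultimately show ?thesis
        using less.prems(1,2) ur vr uv
        by (simp add: pot_step depth_par[of u] depth_par[of v] x y tree_res_Suc_Suc field_simps)
    qed
  qed
qed

section \<open>The Lyapunov equation on a tree\<close>

lemma laplacian_tree:
  assumes "u \<in> S" and a: "\<And>u v. u \<in> S \<Longrightarrow> v \<in> S \<Longrightarrow> a u v = (if u \<noteq> r \<and> v = par u then 1 else 0)"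
  shows "(\<Sum>x\<in>S. laplacian S a u x * f x) = (if u = r then 0 else f u - f (par u))"
proof -
  have row: "(\<Sum>x\<in>S. a u x * f x) = (if u = r then 0 else f (par u))" for f :: "'a \<Rightarrow> real"
  proof -
    have "(\<Sum>x\<in>S. a u x * f x) = (\<Sum>x\<in>S. if x = par u then (if u = r then 0 else f x) else 0)"
      using a assms(1) by (intro sum.cong) auto
    then show ?thesis using assms(1) finite_S par_in by simp
  qed
  \<comment> \<open>The factor 1 lets \<open>row\<close> evaluate the out-degree too.\<close>
  have "(\<Sum>x\<in>S. laplacian S a u x * f x) = (\<Sum>x\<in>S. (if u = x then (\<Sum>x\<in>S. a u x * 1) * f x else 0) - a u x * f x)"
    by (intro sum.cong) (auto simp: laplacian_def algebra_simps)
  also have "\<dots> = (\<Sum>x\<in>S. a u x * 1) * f u - (\<Sum>x\<in>S. a u x * f x)"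
    using assms(1) finite_S by (simp add: sum_subtractf)
  finally show ?thesis unfolding row by simp
qed

text \<open>Subtracting the values in row and column \<open>r\<close> kills \<open>g\<close> and \<open>h\<close>, and turns the equation into a
  recursion along the tree.\<close>
lemma tree_lyap_unique:
  fixes Y :: "'a \<Rightarrow> 'a \<Rightarrow> real"
  assumes Y: "\<And>u v. u \<in> S \<Longrightarrow> v \<in> S \<Longrightarrow>
      (if u = r then 0 else Y u v - Y (par u) v) + (if v = r then 0 else Y u v - Y u (par v)) = g v + h u"
    and "u \<in> S" "v \<in> S"
  shows "Y u v = Y r v + Y u r - Y r r"
  using assms(2,3)
proof (induction "depth u + depth v" arbitrary: u v rule: less_induct)
  case less
  show ?case
  proof (cases "u = r \<or> v = r")
    case False
    then have "Y (par u) v = Y r v + Y (par u) r - Y r r" "Y u (par v) = Y r (par v) + Y u r - Y r r"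
      using less.hyps[of "par u" v] less.hyps[of u "par v"] less.prems
      by (auto simp: par_in depth_par[of u] depth_par[of v])
    then show ?thesis
      using Y[of u v] Y[of u r] Y[of r v] Y[of r r] False less.prems root by (simp split: if_splits)
  qed auto
qed

lemma eff_res_tree:
  assumes a: "\<And>u v. u \<in> S \<Longrightarrow> v \<in> S \<Longrightarrow> a u v = (if u \<noteq> r \<and> v = par u then 1 else 0)"
    and kj: "k \<in> S" "j \<in> S" and "(par ^^ n) k = (par ^^ m) j" "n \<le> depth k" "m \<le> depth j"
    and "\<And>x y. (par ^^ x) k = (par ^^ y) j \<Longrightarrow> n \<le> x \<and> m \<le> y"
  shows "eff_res S a k j = tree_res n m"
proof -
  have lap: "(\<Sum>x\<in>S. laplacian S a u x * f x) = (if u = r then 0 else f u - f (par u))"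
    if "u \<in> S" for u and f :: "'a \<Rightarrow> real"
    using that a by (rule laplacian_tree)
  \<comment> \<open>Away from the root the recursion leaves the constant 2. \<open>g\<close> and
    \<open>h\<close> remove it in row and column \<open>r\<close>, where \<open>pot\<close>
    vanishes, and at \<open>(r, r)\<close> they offset the diagonal 2.\<close>
  have "eff_res S a k j = pot k k + pot j j - 2 * pot k j"
  proof (rule eff_res_eqI[OF finite_S kj, where g = "\<lambda>v. if v = r then -2 else 0" and
        h = "\<lambda>u. 2 - (if u = r then 2 else 0)"])
    fix u v assume uv: "u \<in> S" "v \<in> S"
    then show "pot u v = pot v u" by (rule pot_commute)
    show "(\<Sum>x\<in>S. laplacian S a u x * pot x v) + (\<Sum>x\<in>S. laplacian S a v x * pot u x) =
        (if u = v then 2 else 0) + ((if v = r then - 2 else 0) + (2 - (if u = r then 2 else 0)))"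
      unfolding lap[OF uv(1), of "\<lambda>x. pot x v"] lap[OF uv(2), of "pot u"]
      using uv pot_step[of u v] by (auto simp: pot_root field_simps)
  next
    fix Y :: "'a \<Rightarrow> 'a \<Rightarrow> real" and g h u v u' v'
    assume Y: "\<And>u v. u \<in> S \<Longrightarrow> v \<in> S \<Longrightarrow>
      (\<Sum>x\<in>S. laplacian S a u x * Y x v) + (\<Sum>x\<in>S. laplacian S a v x * Y u x) = g v + h u"
    have "Y u v = Y r v + Y u r - Y r r" if "u \<in> S" "v \<in> S" for u v
    proof (rule tree_lyap_unique[OF _ that])
      fix u v assume uv: "u \<in> S" "v \<in> S"
      show "(if u = r then 0 else Y u v - Y (par u) v) + (if v = r then 0 else Y u v - Y u (par v)) = g v + h u"
        using Y[OF uv] unfolding lap[OF uv(1), of "\<lambda>x. Y x v"] lap[OF uv(2), of "Y u"] .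
    qed
    note * = this
    assume "u \<in> S" "v \<in> S" "u' \<in> S" "v' \<in> S"
    then show "Y u v - Y u' v - Y u v' + Y u' v' = 0"
      using *[of u v] *[of u' v] *[of u v'] *[of u' v'] by simp
  qed
  also have "\<dots> = tree_res n m"
    using pot_meet[of k j n m] pot_ancestor[of k 0] pot_ancestor[of j 0] assms by simp
  finally show ?thesis .
qed

end

section \<open>Connections\<close>

lemma set_zip_tl: "set (zip p (tl p)) = {(p ! i, p ! Suc i) |i. Suc i < length p}"
  unfolding set_zip by (rule Collect_cong, rule ex_cong1) (auto simp: nth_tl less_diff_conv)

lemma dpath_iff_edges: "dpath E p \<longleftrightarrow> p \<noteq> [] \<and> distinct p \<and> set (zip p (tl p)) \<subseteq> E"
  by (auto simp: dpath_def set_zip_tl)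

lemma path_reach_last:
  "x \<in> set p \<Longrightarrow> (x, last p) \<in> (set (zip p (tl p)))\<^sup>*"
proof (induction p arbitrary: x)
  case (Cons y p)
  show ?case
  proof (cases p)
    case Nil
    then show ?thesis using Cons by simp
  next
    case p: (Cons z p')
    have sub: "set (zip p (tl p)) \<subseteq> set (zip (y # p) (tl (y # p)))" "(y, z) \<in> set (zip (y # p) (tl (y # p)))"
      using p by auto
    have "(u, last p) \<in> (set (zip (y # p) (tl (y # p))))\<^sup>*" if "u \<in> set p" for u
      using Cons.IH[OF that] rtrancl_mono[OF sub(1)] by blast
    then show ?thesis using Cons.prems p sub(2) by (auto intro: converse_rtrancl_into_rtrancl)
  qed
qed simp

lemma path_nodes: "set p \<subseteq> insert (hd p) (snd ` set (zip p (tl p)))"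
proof (induction p)
  case (Cons y p)
  then show ?case by (cases p) auto
qed simp

lemma path_edges_in: "set (zip p (tl p)) \<subseteq> set p \<times> set p"
  by (cases p) (auto dest: set_zip_leftD set_zip_rightD)

text \<open>Putting a node in front may close a cycle; then only the part of the path from that node
  on is kept, which is still distinct.\<close>

lemma reach_imp_dpath:
  assumes "(x, y) \<in> E\<^sup>*"
  shows "\<exists>p. dpath E p \<and> hd p = x \<and> last p = y"
  using assms
proof (induction rule: converse_rtrancl_induct)
  case base
  show ?case by (rule exI[of _ "[y]"]) (simp add: dpath_def)
next
  case (step x z)
  then obtain p where p: "dpath E p" "hd p = z" "last p = y" by blast
  show ?case
  proof (cases "x \<in> set p")
    case True
    then obtain ps qs where "p = ps @ x # qs" by (meson split_list)
    moreover have "set (zip (x # qs) qs) \<subseteq> set (zip (ps @ x # qs) (tl (ps @ x # qs)))"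
    proof (induction ps)
      case (Cons a ps)
      then show ?case by (cases "ps @ x # qs") auto
    qed simp
    ultimately show ?thesis using p by (intro exI[of _ "x # qs"]) (auto simp: dpath_iff_edges)
  next
    case False
    then show ?thesis using p step(1)
      by (intro exI[of _ "x # p"]) (cases p; auto simp: dpath_iff_edges)
  qed
qed

text \<open>Connectedness holds because every node of the two paths reaches their common
  end.\<close>

lemma connection_candidate:
  assumes w: "\<forall>u v. 0 < w u v \<longrightarrow> u \<in> V \<and> v \<in> V" and kj: "k \<in> V" "j \<in> V"
    and c: "is_connection (edges w) k j p q"
  shows "conn_candidate V w k j (set p \<union> set q, set (zip p (tl p)) \<union> set (zip q (tl q)))"
proof -
  have p: "p \<noteq> []" "hd p = k" "set (zip p (tl p)) \<subseteq> edges w" 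
    and q: "q \<noteq> []" "hd q = j" "set (zip q (tl q)) \<subseteq> edges w" and l: "last p = last q"
    using c by (auto simp: is_connection_def dpath_iff_edges)
  have "edges w \<subseteq> V \<times> V" using w by (auto simp: edges_def)
  then have "set p \<subseteq> V" "set q \<subseteq> V" using path_nodes[of p] path_nodes[of q] p q kj by fastforce+
  moreover have "(u, last p) \<in> (set (zip p (tl p)) \<union> set (zip q (tl q)))\<^sup>*" if "u \<in> set p \<union> set q" for u
    using that path_reach_last[of u p] path_reach_last[of u q] l
      rtrancl_mono[of "set (zip p (tl p))" "set (zip p (tl p)) \<union> set (zip q (tl q))"]
      rtrancl_mono[of "set (zip q (tl q))" "set (zip p (tl p)) \<union> set (zip q (tl q))"] by auto
  moreover have "last p \<in> set p \<union> set q" using p by simp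
  ultimately show ?thesis
    using p q c path_edges_in[of p] path_edges_in[of q]
    unfolding conn_candidate_def connected_graph_def conn_node_def conn_edge_def fst_conv snd_conv
    by blast
qed

text \<open>Finiteness of \<open>V\<close> bounds the sizes, so some candidate above
  \<open>C\<close> has the most nodes and edges together. It is maximal: a candidate containing it
  cannot have more of either.\<close>

lemma candidate_extends:
  assumes fin: "finite V" and w: "\<forall>u v. 0 < w u v \<longrightarrow> u \<in> V \<and> v \<in> V"
    and C: "conn_candidate V w k j C"
  shows "\<exists>C'. is_conn_subgraph V w k j C' \<and> fst C \<subseteq> fst C' \<and> snd C \<subseteq> snd C'"
proof -
  define P where "P C' \<longleftrightarrow> conn_candidate V w k j C' \<and> fst C \<subseteq> fst C' \<and> snd C \<subseteq> snd C'" for C'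
  define size where "size C' = card (fst C') + card (snd C')" for C' :: "'a set \<times> ('a \<times> 'a) set"
  have E: "edges w \<subseteq> V \<times> V" using w by (auto simp: edges_def)
  have sub: "fst C' \<subseteq> V" "snd C' \<subseteq> V \<times> V" if "P C'" for C'
    using that E unfolding P_def conn_candidate_def by (blast, blast)
  have fin': "finite (fst C')" "finite (snd C')" if "P C'" for C'
    using sub[OF that] fin by (meson finite_SigmaI finite_subset)+
  have "size C' < Suc (card V + card (V \<times> V))" if "P C'" for C'
    unfolding size_def less_Suc_eq_le using sub[OF that] fin by (intro add_mono card_mono) auto
  moreover have "P C" using C by (simp add: P_def)
  ultimately have "\<exists>C'. P C' \<and> (\<forall>D. P D \<longrightarrow> size D \<le> size C')"
    by (intro ex_has_greatest_nat) auto
  then obtain C' where C': "P C'" "\<And>D. P D \<Longrightarrow> size D \<le> size C'" by auto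
  have "D = C'" if D: "conn_candidate V w k j D" "fst C' \<subseteq> fst D" "snd C' \<subseteq> snd D" for D
  proof -
    have PD: "P D" using D C'(1) by (auto simp: P_def)
    have "card (fst C') \<le> card (fst D)" "card (snd C') \<le> card (snd D)"
      using D fin'[OF PD] by (auto intro: card_mono)
    then have "card (fst D) \<le> card (fst C')" "card (snd D) \<le> card (snd C')"
      using C'(2)[OF PD] by (auto simp: size_def)
    then show ?thesis using D fin'[OF PD] by (metis card_seteq prod_eqI)
  qed
  then have "is_conn_subgraph V w k j C'"
    using C'(1) unfolding is_conn_subgraph_def P_def by blast
  then show ?thesis using C'(1) unfolding P_def by blast
qed

text \<open>A connection is itself a candidate, so it lies in a maximal one, which is the connection
  subgraph by uniqueness.\<close>

lemma connection_in_subgraph: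
  assumes "finite V" "\<forall>u v. 0 < w u v \<longrightarrow> u \<in> V \<and> v \<in> V" "k \<in> V" "j \<in> V"
    and "\<exists>!C. is_conn_subgraph V w k j C" "is_connection (edges w) k j p q"
  shows "set p \<union> set q \<subseteq> fst (conn_subgraph V w k j)"
    and "set (zip p (tl p)) \<union> set (zip q (tl q)) \<subseteq> snd (conn_subgraph V w k j)"
proof -
  obtain C where C: "is_conn_subgraph V w k j C" "set p \<union> set q \<subseteq> fst C"
      "set (zip p (tl p)) \<union> set (zip q (tl q)) \<subseteq> snd C"
    using candidate_extends[OF assms(1,2) connection_candidate[OF assms(2,3,4,6)]] by auto
  then have "conn_subgraph V w k j = C" unfolding conn_subgraph_def using assms(5) by blast
  then show "set p \<union> set q \<subseteq> fst (conn_subgraph V w k j)"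
    "set (zip p (tl p)) \<union> set (zip q (tl q)) \<subseteq> snd (conn_subgraph V w k j)" using C by auto
qed

section \<open>Directed paths in a rooted tree\<close>

context rooted_tree
begin

text \<open>Up to the depth, the iterates of \<open>par\<close> have strictly falling depths and so
  are distinct.\<close>

lemma tree_dpath:
  assumes F: "\<And>u v. (u, v) \<in> F \<longleftrightarrow> u \<in> S \<and> u \<noteq> r \<and> v = par u"
    and u: "u \<in> S" and l: "l \<le> depth u"
  shows "\<exists>p. dpath F p \<and> hd p = u \<and> length p = Suc l \<and> last p = (par ^^ l) u"
proof (intro exI[of _ "map (\<lambda>i. (par ^^ i) u) [0..<Suc l]"] conjI)
  have "inj_on (\<lambda>i. (par ^^ i) u) {0..<Suc l}"
  proof (rule inj_onI)
    fix i i' assume i: "i \<in> {0..<Suc l}" "i' \<in> {0..<Suc l}" "(par ^^ i) u = (par ^^ i') u"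
    then have "depth u - i = depth u - i'" using depth_par_pow[OF u] by metis
    then show "i = i'" using i l by auto
  qed
  moreover have "((par ^^ i) u, (par ^^ Suc i) u) \<in> F" if "i < l" for i
    using that l depth_par_pow[OF u, of i] depth_eq_0_iff[OF par_pow_in[OF u], of i] par_pow_in[OF u] by (simp add: F)
  ultimately show "dpath F (map (\<lambda>i. (par ^^ i) u) [0..<Suc l])"
    by (auto simp: dpath_def distinct_map nth_append simp del: upt_Suc funpow.simps)
  show "hd (map (\<lambda>i. (par ^^ i) u) [0..<Suc l]) = u" by (simp add: upt_conv_Cons del: upt_Suc)
qed simp_all

text \<open>At most one edge leaves each node, so the path is forced; it cannot continue past the
  root, which bounds its length.\<close>

lemma dpath_in_tree:
  assumes F: "\<And>u v. (u, v) \<in> F \<longleftrightarrow> u \<in> S \<and> u \<noteq> r \<and> v = par u"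
    and p: "dpath F p" "hd p \<in> S" "length p = Suc l"
  shows "last p = (par ^^ l) (hd p)" "l \<le> depth (hd p)"
proof -
  have step: "p ! i = (par ^^ i) (hd p)" if "i < length p" for i
    using that
  proof (induction i)
    case 0
    then show ?case by (simp add: hd_conv_nth)
  next
    case (Suc i)
    then have "(p ! i, p ! Suc i) \<in> F" using p(1) unfolding dpath_def by blast
    then have "p ! Suc i = par (p ! i)" by (simp only: F)
    then show ?case using Suc by simp
  qed
  show "last p = (par ^^ l) (hd p)" using step[of l] p by (metis diff_Suc_1 last_conv_nth lessI length_0_conv nat.simps(3))
  show "l \<le> depth (hd p)"
  proof (rule ccontr)
    assume "\<not> l \<le> depth (hd p)"
    then have l: "Suc (depth (hd p)) < length p" using p by simp
    then have "(p ! depth (hd p), p ! Suc (depth (hd p))) \<in> F" using p(1) unfolding dpath_def by blast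
    moreover have "p ! depth (hd p) = r" using step l par_pow_depth[OF p(2)] by simp
    ultimately show False by (simp add: F)
  qed
qed

text \<open>A path in \<open>E\<close> to a node that \<open>j\<close> also reaches forms a
  connection with a path from \<open>j\<close>, so both run inside the tree. Reachability in the
  whole graph thus reduces to ancestors.\<close>

lemma short_len_tree:
  assumes F: "\<And>u v. (u, v) \<in> F \<longleftrightarrow> u \<in> S \<and> u \<noteq> r \<and> v = par u"
    and FE: "F \<subseteq> E" and kj: "k \<in> S" "j \<in> S"
    and con: "\<And>p q. is_connection E k j p q \<Longrightarrow> dpath F p \<and> dpath F q"
  shows "short_len E k j = (LEAST l. l \<le> depth k \<and> (\<exists>b. (par ^^ b) j = (par ^^ l) k))"
proof -
  have "(\<exists>p. dpath E p \<and> hd p = k \<and> length p = Suc l \<and> (k, last p) \<in> E\<^sup>* \<and> (j, last p) \<in> E\<^sup>*)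
    \<longleftrightarrow> l \<le> depth k \<and> (\<exists>b. (par ^^ b) j = (par ^^ l) k)" (is "?L \<longleftrightarrow> ?R") for l
  proof
    assume ?L
    then obtain p where p: "dpath E p" "hd p = k" "length p = Suc l" "(j, last p) \<in> E\<^sup>*" by blast
    then obtain q where q: "dpath E q" "hd q = j" "last q = last p" using reach_imp_dpath by metis
    then have F': "dpath F p" "dpath F q" using con[of p q] p unfolding is_connection_def by metis+
    obtain b where b: "length q = Suc b" using q by (cases q) (auto simp: dpath_def)
    show ?R using dpath_in_tree[OF F F'(1)] dpath_in_tree[OF F F'(2)] p q b kj by metis
  next
    have mono: "dpath E p" if "dpath F p" for p using that FE by (auto simp: dpath_def)
    have reach: "(hd p, last p) \<in> E\<^sup>*" if "dpath E p" for p
      using that path_reach_last[of "hd p" p] rtrancl_mono[of "set (zip p (tl p))" E]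
      by (auto simp: dpath_iff_edges)
    have pow: "(u, (par ^^ b) u) \<in> E\<^sup>*" if "u \<in> S" for u b
    proof (induction b)
      case (Suc b)
      show ?case
      proof (cases "(par ^^ b) u = r")
        case False
        then have "((par ^^ b) u, par ((par ^^ b) u)) \<in> E" using par_pow_in[OF that] F FE by blast
        then show ?thesis using Suc by simp
      qed (use Suc par_root in simp)
    qed simp
    assume R: ?R
    then obtain p where "dpath F p" "hd p = k" "length p = Suc l" "last p = (par ^^ l) k"
      using tree_dpath[OF F kj(1)] by blast
    then show ?L using mono reach pow[OF kj(2)] R by metis
  qed
  then show ?thesis by (simp add: short_len_def)
qed

lemma par_pow_min_depth: "u \<in> S \<Longrightarrow> (par ^^ min b (depth u)) u = (par ^^ b) u"
proof (cases "b \<le> depth u")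
  case False
  assume "u \<in> S"
  moreover have "(par ^^ b) u = (par ^^ (b - depth u)) ((par ^^ depth u) u)"
    using False by (metis comp_apply funpow_add le_add_diff_inverse2 nat_le_linear)
  ultimately show ?thesis using False by (simp add: par_pow_depth par_pow_root)
qed (simp add: min_def)

text \<open>\<open>n\<close> and \<open>m\<close> are minimised separately, so a common meeting node
  is not immediate. With \<open>a'\<close> and \<open>b'\<close> the partner distances, comparing
  depths gives \<open>a' + b' = n + m\<close>, and minimality gives \<open>n \<le> a'\<close> and
  \<open>m \<le> b'\<close>; so equality holds.\<close>

lemma first_meeting:
  assumes kj: "k \<in> S" "j \<in> S"
    and n: "n = (LEAST l. l \<le> depth k \<and> (\<exists>b. (par ^^ b) j = (par ^^ l) k))"
    and m: "m = (LEAST l. l \<le> depth j \<and> (\<exists>b. (par ^^ b) k = (par ^^ l) j))"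
  shows "(par ^^ n) k = (par ^^ m) j" "n \<le> depth k" "m \<le> depth j"
    "\<And>x y. (par ^^ x) k = (par ^^ y) j \<Longrightarrow> n \<le> x \<and> m \<le> y"
proof -
  define P where "P l \<longleftrightarrow> l \<le> depth k \<and> (\<exists>b. (par ^^ b) j = (par ^^ l) k)" for l
  define R where "R l \<longleftrightarrow> l \<le> depth j \<and> (\<exists>b. (par ^^ b) k = (par ^^ l) j)" for l
  have n': "n = (LEAST l. P l)" and m': "m = (LEAST l. R l)"
    unfolding n m P_def R_def by (rule refl)+
  have "(par ^^ depth k) k = (par ^^ depth j) j"
    using kj by (simp add: par_pow_depth)
  then have "P (depth k)" "R (depth j)" unfolding P_def R_def by (metis order_refl)+
  then have "P n" "R m" unfolding n' m' by (metis LeastI)+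
  then obtain a b where nb: "n \<le> depth k" "(par ^^ b) j = (par ^^ n) k"
    and ma: "m \<le> depth j" "(par ^^ a) k = (par ^^ m) j"
    unfolding P_def R_def by metis
  show min: "n \<le> x \<and> m \<le> y" if "(par ^^ x) k = (par ^^ y) j" for x y
  proof
    show "n \<le> x"
    proof (cases "x \<le> depth k")
      case True
      then have "P x" unfolding P_def using that[symmetric] by blast
      then show ?thesis unfolding n' by (rule Least_le)
    qed (use nb in simp)
    show "m \<le> y"
    proof (cases "y \<le> depth j")
      case True
      then have "R y" unfolding R_def using that by blast
      then show ?thesis unfolding m' by (rule Least_le)
    qed (use ma in simp)
  qed
  \<comment> \<open>Capping at the depth makes the subtractions of natural numbers below
    exact.\<close>
  define a' b' where "a' = min a (depth k)" and "b' = min b (depth j)"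
  have b': "(par ^^ b') j = (par ^^ n) k" and a': "(par ^^ a') k = (par ^^ m) j"
    using nb ma par_pow_min_depth kj by (simp_all add: a'_def b'_def)
  have "depth j - b' = depth k - n" "depth k - a' = depth j - m"
    using arg_cong[OF b', of depth] arg_cong[OF a', of depth] depth_par_pow kj by simp_all
  moreover have "m \<le> b'" "n \<le> a'" using min[of n b'] min[of a' m] a' b' by simp_all
  moreover have "a' \<le> depth k" "b' \<le> depth j" by (simp_all add: a'_def b'_def)
  ultimately have "b' = m" using nb ma by linarith
  then show "(par ^^ n) k = (par ^^ m) j" using b' by simp
  show "n \<le> depth k" "m \<le> depth j" using nb ma by blast+
qed

end

lemma directed_tree_par:
  assumes "finite S" "directed_tree S F"
  obtains r par where "rooted_tree S r par" "\<And>u v. (u, v) \<in> F \<longleftrightarrow> u \<in> S \<and> u \<noteq> r \<and> v = par u"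
proof -
  have FS: "F \<subseteq> S \<times> S" using assms(2) by (simp add: directed_tree_def)
  obtain r where r: "r \<in> S" "\<And>v. (r, v) \<notin> F"
    and ex: "\<forall>u\<in>S - {r}. \<exists>!v. (u, v) \<in> F" and reach: "\<And>u. u \<in> S \<Longrightarrow> (u, r) \<in> F\<^sup>*"
    using assms(2) unfolding directed_tree_def by (elim conjE bexE) simp
  have ex1: "\<exists>!v. (u, v) \<in> F" if "u \<in> S" "u \<noteq> r" for u using ex that by simp
  \<comment> \<open>The value at \<open>r\<close> is set by hand, as no edge leaves the
    root.\<close>
  define par where "par u = (if u = r then r else THE v. (u, v) \<in> F)" for u
  have F: "(u, v) \<in> F \<longleftrightarrow> u \<in> S \<and> u \<noteq> r \<and> v = par u" for u v
  proof
    assume uv: "(u, v) \<in> F"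
    then have "u \<in> S" "u \<noteq> r" using FS r by auto
    moreover from this have "(THE v. (u, v) \<in> F) = v" using uv ex1 by blast
    ultimately show "u \<in> S \<and> u \<noteq> r \<and> v = par u" by (simp add: par_def)
  next
    assume u: "u \<in> S \<and> u \<noteq> r \<and> v = par u"
    then show "(u, v) \<in> F" using theI'[OF ex1[of u]] by (simp add: par_def)
  qed
  have "rooted_tree S r par"
  proof
    show "par u \<in> S" if "u \<in> S" for u
      using that F[of u "par u"] FS r(1) by (cases "u = r") (auto simp: par_def)
    show "par r = r" by (simp add: par_def)
    show "\<exists>l. (par ^^ l) u = r" if "u \<in> S" for u
      using reach[OF that]
    proof (induction rule: converse_rtrancl_induct)
      case base
      show ?case by (rule exI[of _ 0]) simp
    next
      case (step u v)
      then obtain l where "(par ^^ l) v = r" "v = par u" using F by blast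
      then show ?case by (intro exI[of _ "Suc l"]) (simp add: funpow_Suc_right del: funpow.simps)
    qed
  qed (use assms r in auto)
  then show ?thesis using that F by blast
qed

theorem theorem3:
  fixes V :: "'a set" and w :: "'a \<Rightarrow> 'a \<Rightarrow> real" and k j :: 'a and n m :: nat
  assumes "finite V"
    and "\<forall>u v. 0 \<le> w u v"
    and "\<forall>u v. 0 < w u v \<longrightarrow> u \<in> V \<and> v \<in> V"
    and "k \<in> V" and "j \<in> V" and "k \<noteq> j"
    and "\<exists>!C. is_conn_subgraph V w k j C"
    and "directed_tree (fst (conn_subgraph V w k j)) (snd (conn_subgraph V w k j))"
    and "\<forall>(u, v) \<in> snd (conn_subgraph V w k j). w u v = 1"
    and "n = short_len (edges w) k j"
    and "m = short_len (edges w) j k"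
  shows "resistance V w k j =
     2 * (real n - real m) + (2::real) powi (3 - int n - int m) *
       (\<Sum>i = 1..(m + 1) div 2. real i * real ((n + m + 2) choose (n + 2 * i + 1)))"
proof -
  define S F where "S = fst (conn_subgraph V w k j)" and "F = snd (conn_subgraph V w k j)"
  have "is_conn_subgraph V w k j (conn_subgraph V w k j)"
    unfolding conn_subgraph_def using assms(7) by (rule theI')
  then have cand: "conn_candidate V w k j (S, F)"
    by (simp add: is_conn_subgraph_def S_def F_def)
  have con: "set p \<union> set q \<subseteq> S \<and> dpath F p \<and> dpath F q" if "is_connection (edges w) k j p q" for p q
    using connection_in_subgraph[OF assms(1,3,4,5,7) that] that
    by (auto simp: S_def F_def is_connection_def dpath_iff_edges)
  have "finite S" using cand assms(1) finite_subset by (auto simp: conn_candidate_def)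
  then obtain r par where tree: "rooted_tree S r par"
    and F: "\<And>u v. (u, v) \<in> F \<longleftrightarrow> u \<in> S \<and> u \<noteq> r \<and> v = par u"
    using directed_tree_par[of S F] assms(8) unfolding S_def F_def by blast
  interpret rooted_tree S r par by (rule tree)
  \<comment> \<open>The root lies on some connection, and that connection runs inside
    \<open>S\<close>; this places \<open>k\<close> and \<open>j\<close> in the tree.\<close>
  obtain p q where pq: "is_connection (edges w) k j p q"
    using cand root by (auto simp: conn_candidate_def conn_node_def)
  then have "k \<in> set p" "j \<in> set q" by (auto simp: is_connection_def dpath_def)
  then have kj: "k \<in> S" "j \<in> S" using con[OF pq] by auto
  have FE: "F \<subseteq> edges w" using cand by (simp add: conn_candidate_def)
  have n: "n = (LEAST l. l \<le> depth k \<and> (\<exists>b. (par ^^ b) j = (par ^^ l) k))"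
    unfolding assms(10) by (rule short_len_tree[OF F FE kj]) (use con in blast)
  \<comment> \<open>Swapping its two paths turns a connection between \<open>j\<close> and
    \<open>k\<close> into one between \<open>k\<close> and \<open>j\<close>.\<close>
  have m: "m = (LEAST l. l \<le> depth j \<and> (\<exists>b. (par ^^ b) k = (par ^^ l) j))"
    unfolding assms(11)
    by (rule short_len_tree[OF F FE kj(2,1)]) (use con in \<open>metis is_connection_def\<close>)
  have unit: "w u v = 1" if "(u, v) \<in> F" for u v
    using assms(9) that unfolding F_def by blast
  have "restrict_w w F u v = (if u \<noteq> r \<and> v = par u then 1 else 0)" if "u \<in> S" "v \<in> S" for u v
    using F[of u v] unit[of u v] that by (simp add: restrict_w_def)
  then have "eff_res S (restrict_w w F) k j = tree_res n m"
    using kj first_meeting[OF kj n m] by (rule eff_res_tree)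
  then show ?thesis by (simp add: resistance_def S_def F_def Let_def tree_res_def)
qed

end
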